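(* Let $\mu,\kappa$ be real numbers with $0<\mu<1$ and $0<\kappa<1$. Define sequences $(a_n)_{n\ge0}$ and $(b_n)_{n\ge 0}$ by $a_0=\mu$, $b_0=\kappa$ and, for $n\ge 0$, $$a_{n+1} = \mu\,(1-b_n),\qquad b_{n+1} = \kappa\,(1-a_n).$$ Then both sequences converge, and their limits $a^* = \lim_{n\to\infty} a_n$ and $b^* = \lim_{n\to\infty} b_n$ are $$a^* = \frac{\mu\,(1-\kappa)}{1-\mu\kappa},\qquad b^* = \frac{\kappa\,(1-\mu)}{1-\mu\kappa}.$$ That is, the $\infty$-M&M Cookie has M&M-material fraction $a^*$ and cookie-dough fraction $1-a^*$, and the $\infty$-Crunchy Cookie M&M has cookie-dough fraction $b^*$ and M&M-material fraction $1-b^*$.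
   Context: Every product is a mixture of two materials, cookie dough and M&M material, with mass fractions summing to $1$. For foods $A,B$, the product $A\ast B$ is the food obtained by mixing $A$ into $B$. With $M$ = M&M and $C$ = Cookie, put $P_0 = M\ast C$, $Q_0 = C\ast M$, and $P_{n+1} = Q_n\ast C$, $Q_{n+1} = P_n\ast M$. At each step the mix-in makes up a mass fraction $\mu$ of $P_n$ (the remaining $1-\mu$ being cookie dough) and a mass fraction $\kappa$ of $Q_n$ (the remaining $1-\kappa$ being M&M material). $a_n$ denotes the mass fraction of $P_n$ that is M&M material and $b_n$ the mass fraction of $Q_n$ that is cookie dough; these satisfy the recursion in the claim. The $\infty$-M&M Cookie and the $\infty$-Crunchy Cookie M&M are the limits of $P_n$ and $Q_n$ respectively, so their composition fractions are the limits of $a_n$ and $b_n$. *)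

theory Defs
  imports Complex_Main "HOL-Analysis.Product_Vector"
begin

text \<open>A food is recorded by its composition: (mass fraction of M&M material, mass fraction of cookie
  dough). All foods below are obtained by mixing from the two pure materials, so their two
  fractions sum to 1.\<close>

type_synonym food = "real \<times> real"

definition mm_fraction :: "food \<Rightarrow> real" where
  "mm_fraction X = fst X"

definition cookie_fraction :: "food \<Rightarrow> real" where
  "cookie_fraction X = snd X"

definition MM :: food where
  "MM = (1, 0)"

definition Cookie :: food where
  "Cookie = (0, 1)"

text \<open>The product \<open>A \<^bold>* B\<close> (\<open>A\<close> mixed into \<open>B\<close>), where the mix-in \<open>A\<close> makes up the mass fraction \<open>t\<close>
  of the result: the masses of each material add up.\<close>

definition mix :: "real \<Rightarrow> food \<Rightarrow> food \<Rightarrow> food" where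
  "mix t A B =
     (t * mm_fraction A + (1 - t) * mm_fraction B,
      t * cookie_fraction A + (1 - t) * cookie_fraction B)"

fun mm_cookie :: "real \<Rightarrow> real \<Rightarrow> nat \<Rightarrow> food"
  and crunchy_cookie_mm :: "real \<Rightarrow> real \<Rightarrow> nat \<Rightarrow> food" where
  "mm_cookie \<mu> \<kappa> 0 = mix \<mu> MM Cookie"
| "mm_cookie \<mu> \<kappa> (Suc n) = mix \<mu> (crunchy_cookie_mm \<mu> \<kappa> n) Cookie"
| "crunchy_cookie_mm \<mu> \<kappa> 0 = mix \<kappa> Cookie MM"
| "crunchy_cookie_mm \<mu> \<kappa> (Suc n) = mix \<kappa> (mm_cookie \<mu> \<kappa> n) MM"

text \<open>The limit products; \<^const>\<open>lim\<close> is meaningful only for convergent sequences, so convergence has to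
  be asserted separately.\<close>

definition infinity_mm_cookie :: "real \<Rightarrow> real \<Rightarrow> food" where
  "infinity_mm_cookie \<mu> \<kappa> = lim (mm_cookie \<mu> \<kappa>)"

definition infinity_crunchy_cookie_mm :: "real \<Rightarrow> real \<Rightarrow> food" where
  "infinity_crunchy_cookie_mm \<mu> \<kappa> = lim (crunchy_cookie_mm \<mu> \<kappa>)"

end

theory Submission imports Defs begin

text \<open>The affine map (x, y) \<mapsto> (\<mu> (1 - y), \<kappa> (1 - x)) has exactly one fixed
  point, since \<mu> \<kappa> \<noteq> 1, and it is the claimed pair of limits. The deviations from
  it obey the same recursion without constant terms: they swap places and are scaled by -\<mu> and
  -\<kappa>, so they die out geometrically (\<open>alternating_contraction_tendsto_zero\<close>,
  \<open>coupled_recursion_tendsto\<close>). The foods are the pairs (a n, 1 - a n) and (1 - b n, b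
  n) (\<open>mm_cookie_crunchy_cookie_mm_eq\<close>), so their limits can be read off
  coordinatewise.\<close>

text \<open>Every step costs at least a factor r = max \<bar>\<mu>\<bar> \<bar>\<kappa>\<bar> < 1.
  As each sequence feeds the other, the geometric bound is proved for both in one induction, with a
  common constant C.\<close>

lemma alternating_contraction_tendsto_zero:
  fixes e f :: "nat \<Rightarrow> real"
  assumes "\<bar>\<mu>\<bar> < 1" "\<bar>\<kappa>\<bar> < 1"
    and e: "\<And>n. e (Suc n) = \<mu> * f n"
    and f: "\<And>n. f (Suc n) = \<kappa> * e n"
  shows "e \<longlonglongrightarrow> 0" "f \<longlonglongrightarrow> 0"
proof -
  define r where "r = max \<bar>\<mu>\<bar> \<bar>\<kappa>\<bar>"
  define C where "C = max \<bar>e 0\<bar> \<bar>f 0\<bar>"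
  have r: "0 \<le> r" "r < 1" "\<bar>\<mu>\<bar> \<le> r" "\<bar>\<kappa>\<bar> \<le> r"
    using assms(1,2) by (auto simp: r_def)
  have bound: "\<bar>e n\<bar> \<le> r ^ n * C \<and> \<bar>f n\<bar> \<le> r ^ n * C" for n
  proof (induction n)
    case 0
    then show ?case by (simp add: C_def)
  next
    case (Suc n)
    then show ?case
      using mult_mono[of "\<bar>\<mu>\<bar>" r "\<bar>f n\<bar>" "r ^ n * C"]
        mult_mono[of "\<bar>\<kappa>\<bar>" r "\<bar>e n\<bar>" "r ^ n * C"] r
      by (simp add: e f abs_mult mult.assoc)
  qed
  have "(\<lambda>n. r ^ n * C) \<longlonglongrightarrow> 0"
    using r by (intro tendsto_mult_left_zero LIMSEQ_realpow_zero)
  \<comment> \<open>The absolute value and the factor 1 give the bound the shape that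
    \<open>tendsto_0_le\<close> expects for K = 1.\<close>
  moreover have "\<bar>e n\<bar> \<le> \<bar>r ^ n * C\<bar> * 1" "\<bar>f n\<bar> \<le> \<bar>r ^ n * C\<bar> * 1" for n
    using bound[of n] by linarith+
  ultimately show "e \<longlonglongrightarrow> 0" "f \<longlonglongrightarrow> 0"
    by (auto intro!: tendsto_0_le[where K = 1 and f = "\<lambda>n. r ^ n * C"] always_eventually
        simp del: mult_1_right)
qed

text \<open>The fixed point attracts every initial pair: shifting it to the origin turns the affine
  recursion into the linear one above.\<close>

lemma coupled_recursion_tendsto:
  fixes a b :: "nat \<Rightarrow> real"
  assumes "\<bar>\<mu>\<bar> < 1" "\<bar>\<kappa>\<bar> < 1"
    and a: "\<And>n. a (Suc n) = \<mu> * (1 - b n)"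
    and b: "\<And>n. b (Suc n) = \<kappa> * (1 - a n)"
  shows "a \<longlonglongrightarrow> \<mu> * (1 - \<kappa>) / (1 - \<mu> * \<kappa>)" (is "a \<longlonglongrightarrow> ?A")
    and "b \<longlonglongrightarrow> \<kappa> * (1 - \<mu>) / (1 - \<mu> * \<kappa>)" (is "b \<longlonglongrightarrow> ?B")
proof -
  have "\<bar>\<mu> * \<kappa>\<bar> < 1"
    using abs_mult_less[OF assms(1,2)] by (simp add: abs_mult)
  then have "1 - \<mu> * \<kappa> \<noteq> 0"
    by auto
  \<comment> \<open>Over the common denominator, 1 - ?B = (1 - \<kappa>) / (1 - \<mu> * \<kappa>),
    and symmetrically for ?A.\<close>
  then have fixed: "?A = \<mu> * (1 - ?B)" "?B = \<kappa> * (1 - ?A)"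
    by (simp_all add: field_simps)
  have "a (Suc n) - ?A = - \<mu> * (b n - ?B)" for n
    using fixed(1) unfolding a by algebra
  moreover have "b (Suc n) - ?B = - \<kappa> * (a n - ?A)" for n
    using fixed(2) unfolding b by algebra
  ultimately have "(\<lambda>n. a n - ?A) \<longlonglongrightarrow> 0" "(\<lambda>n. b n - ?B) \<longlonglongrightarrow> 0"
    using alternating_contraction_tendsto_zero
      [of "- \<mu>" "- \<kappa>" "\<lambda>n. a n - ?A" "\<lambda>n. b n - ?B"] assms(1,2)
    by simp_all
  then show "a \<longlonglongrightarrow> ?A" "b \<longlonglongrightarrow> ?B"
    by (simp_all add: LIM_zero_iff)
qed

text \<open>The base material of each mix contributes nothing to the tracked fraction, which is thus
  \<mu> or \<kappa> times the corresponding fraction of the mix-in. Carrying both coordinates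
  through the induction supplies that fraction as 1 - b n or 1 - a n.\<close>

lemma mm_cookie_crunchy_cookie_mm_eq:
  assumes "a 0 = \<mu>" "b 0 = \<kappa>"
    and "\<And>n. a (Suc n) = \<mu> * (1 - b n)"
    and "\<And>n. b (Suc n) = \<kappa> * (1 - a n)"
  shows "mm_cookie \<mu> \<kappa> n = (a n, 1 - a n) \<and> crunchy_cookie_mm \<mu> \<kappa> n = (1 - b n, b n)"
  by (induction n)
    (simp_all add: assms mix_def mm_fraction_def cookie_fraction_def MM_def Cookie_def algebra_simps)

theorem theorem4p10:
  fixes \<mu> \<kappa> :: real and a b :: "nat \<Rightarrow> real"
  assumes "0 < \<mu>" and "\<mu> < 1" and "0 < \<kappa>" and "\<kappa> < 1"
    and "a 0 = \<mu>" and "b 0 = \<kappa>"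
    and "\<And>n. a (Suc n) = \<mu> * (1 - b n)"
    and "\<And>n. b (Suc n) = \<kappa> * (1 - a n)"
  defines "a_lim \<equiv> \<mu> * (1 - \<kappa>) / (1 - \<mu> * \<kappa>)"
    and "b_lim \<equiv> \<kappa> * (1 - \<mu>) / (1 - \<mu> * \<kappa>)"
  shows "a \<longlonglongrightarrow> a_lim \<and> b \<longlonglongrightarrow> b_lim
    \<and> (\<forall>n. mm_fraction (mm_cookie \<mu> \<kappa> n) = a n
          \<and> cookie_fraction (crunchy_cookie_mm \<mu> \<kappa> n) = b n)
    \<and> convergent (mm_cookie \<mu> \<kappa>) \<and> convergent (crunchy_cookie_mm \<mu> \<kappa>)
    \<and> mm_fraction (infinity_mm_cookie \<mu> \<kappa>) = a_lim
    \<and> cookie_fraction (infinity_mm_cookie \<mu> \<kappa>) = 1 - a_lim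
    \<and> cookie_fraction (infinity_crunchy_cookie_mm \<mu> \<kappa>) = b_lim
    \<and> mm_fraction (infinity_crunchy_cookie_mm \<mu> \<kappa>) = 1 - b_lim"
proof -
  have lims: "a \<longlonglongrightarrow> a_lim" "b \<longlonglongrightarrow> b_lim"
    unfolding a_lim_def b_lim_def
    using coupled_recursion_tendsto[of \<mu> \<kappa> a b] assms(1-4,7,8) by simp_all
  have foods: "mm_cookie \<mu> \<kappa> = (\<lambda>n. (a n, 1 - a n))"
    "crunchy_cookie_mm \<mu> \<kappa> = (\<lambda>n. (1 - b n, b n))"
    using mm_cookie_crunchy_cookie_mm_eq[of a \<mu> b \<kappa>] assms(5-8) by auto
  \<comment> \<open>Convergence in the product space is coordinatewise; uniqueness of limits then
    evaluates \<open>lim\<close> in the two infinity products.\<close>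
  have food_lims: "mm_cookie \<mu> \<kappa> \<longlonglongrightarrow> (a_lim, 1 - a_lim)"
    "crunchy_cookie_mm \<mu> \<kappa> \<longlonglongrightarrow> (1 - b_lim, b_lim)"
    unfolding foods by (intro tendsto_intros lims)+
  then have "infinity_mm_cookie \<mu> \<kappa> = (a_lim, 1 - a_lim)"
    "infinity_crunchy_cookie_mm \<mu> \<kappa> = (1 - b_lim, b_lim)"
    by (simp_all add: infinity_mm_cookie_def infinity_crunchy_cookie_mm_def limI)
  with lims food_lims show ?thesis
    by (auto simp: foods mm_fraction_def cookie_fraction_def convergent_def)
qed

end
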